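(* Let $p\ge 1$ be an integer and let $X=\{X(t)=(X_1(t),\dots,X_p(t)),\ t\in\mathbb{R}\}$ be a second-order process (i.e. $\mathrm{E}\,X_i(t)^2<\infty$ for all $i,t$) with values in $\mathbb{R}^p$. Assume that $X$ has stationary increments, zero mean, $X(0)=0$, and that $X$ is vector self-similar with exponent $H=\mathrm{diag}(H_1,\dots,H_p)$, where $0<H_i<1$ for $i=1,\dots,p$. Assume moreover that for any $i,j=1,\dots,p$ the function $t\mapsto \mathrm{E}\,X_i(t)X_j(1)$ is continuously differentiable on $(0,1)\cup(1,\infty)$. Let $\sigma_i^2>0$ denote the variance of $X_i(1)$, $i=1,\dots,p$ (with $\sigma_i>0$). Then the following hold. (i) If $i=j$, then for any $(s,t)\in\mathbb{R}^2$, $$\mathrm{E}\,X_i(s)X_i(t)=\frac{\sigma_i^2}{2}\left\{|s|^{2H_i}+|t|^{2H_i}-|t-s|^{2H_i}\right\}.$$ (ii) If $i\neq j$ and $H_i+H_j\neq 1$, then there exist $c_{ij},c_{ji}\in\mathbb{R}$ such that for any $(s,t)\in\mathbb{R}^2$, $$\mathrm{cov}(X_i(s),X_j(t))=\mathrm{E}\,X_i(s)X_j(t)=\frac{\sigma_i\sigma_j}{2}\left\{c_{ij}(s)|s|^{H_i+H_j}+c_{ji}(t)|t|^{H_i+H_j}-c_{ji}(t-s)|t-s|^{H_i+H_j}\right\},$$ where $c_{ij}(u):=c_{ij}$ for $u>0$ and $c_{ij}(u):=c_{ji}$ for $u<0$, and likewise $c_{ji}(u):=c_{ji}$ for $u>0$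 and $c_{ji}(u):=c_{ij}$ for $u<0$. (iii) If $i\neq j$ and $H_i+H_j=1$, then there exist $d_{ij},f_{ij}\in\mathbb{R}$ such that for any $(s,t)\in\mathbb{R}^2$, $$\mathrm{E}\,X_i(s)X_j(t)=\frac{\sigma_i\sigma_j}{2}\left\{d_{ij}\,(|s|+|t|-|s-t|)+f_{ij}\,\bigl(t\log|t|-s\log|s|-(t-s)\log|t-s|\bigr)\right\}.$$ (iv) The matrix $R=(R_{ij})_{i,j=1,\dots,p}$ is positive definite, where, with the constants from (ii) and (iii), $$R_{ij}:=\begin{cases}1, & i=j,\\ c_{ij}+c_{ji}, & i\neq j,\ H_i+H_j\neq 1,\\ d_{ij}, & i\neq j,\ H_i+H_j=1.\end{cases}$$
   Context: Here $=_{\rm fdd}$ means equality of finite-dimensional distributions. A process $X=\{X(t),t\in\mathbb{R}\}$ with values in $\mathbb{R}^p$ has stationary increments if $\{X(t+T)-X(T),\ t\in\mathbb{R}\}=_{\rm fdd}\{X(t)-X(0),\ t\in\mathbb{R}\}$ for any $T\in\mathbb{R}$. It is vector self-similar with exponent $H=\mathrm{diag}(H_1,\dots,H_p)$ if for every $\lambda>0$, as processes in $t\in\mathbb{R}$, $(X_1(\lambda t),\dots,X_p(\lambda t))=_{\rm fdd}(\lambda^{H_1}X_1(t),\dots,\lambda^{H_p}X_p(t))$. Conventions: $0\log 0=0$; terms of the form $c(u)|u|^{a}$ with $a>0$ are $0$ when $u=0$, so the value of $c_{ij}(\cdot)$ at $0$ is irrelevant.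
   Formalization: In (iv), for i≠j and H_i+H_j≠1 the entry R_ij is (c_ij+c_ji)/2 instead of c_ij+c_ji, and "positive definite" means symmetric with x^T R x ≥ 0 (not strict); as printed (iv) fails for p=2 with X_1=X_2 a fractional Brownian motion, H≠1/2. *)

theory Defs
  imports "HOL-Probability.Probability"
begin

definition fdd_eq ::
    "'a measure \<Rightarrow> ('t \<Rightarrow> 'a \<Rightarrow> 'b::topological_space) \<Rightarrow> ('t \<Rightarrow> 'a \<Rightarrow> 'b) \<Rightarrow> bool" where
  "fdd_eq M X Y \<longleftrightarrow>
     (\<forall>J. finite J \<longrightarrow>
        distr M (\<Pi>\<^sub>M t\<in>J. borel) (\<lambda>\<omega>. \<lambda>t\<in>J. X t \<omega>) =
        distr M (\<Pi>\<^sub>M t\<in>J. borel) (\<lambda>\<omega>. \<lambda>t\<in>J. Y t \<omega>))"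

definition stationary_increments ::
    "'a measure \<Rightarrow> (real \<Rightarrow> 'a \<Rightarrow> real ^ 'p) \<Rightarrow> bool" where
  "stationary_increments M X \<longleftrightarrow>
     (\<forall>T. fdd_eq M (\<lambda>t \<omega>. X (t + T) \<omega> - X T \<omega>) (\<lambda>t \<omega>. X t \<omega> - X 0 \<omega>))"

text \<open>The exponent diag(H_1, ..., H_p) is represented by the vector of its diagonal entries.\<close>

definition vector_self_similar ::
    "'a measure \<Rightarrow> real ^ 'p \<Rightarrow> (real \<Rightarrow> 'a \<Rightarrow> real ^ 'p) \<Rightarrow> bool" where
  "vector_self_similar M H X \<longleftrightarrow>
     (\<forall>a>0. fdd_eq M (\<lambda>t. X (a * t)) (\<lambda>t \<omega>. \<chi> i. a powr (H $ i) * X t \<omega> $ i))"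

definition covariance :: "'a measure \<Rightarrow> ('a \<Rightarrow> real) \<Rightarrow> ('a \<Rightarrow> real) \<Rightarrow> real" where
  "covariance M U V =
     (LINT \<omega>|M. (U \<omega> - (LINT \<omega>|M. U \<omega>)) * (V \<omega> - (LINT \<omega>|M. V \<omega>)))"

text \<open>
  The function written c_ij(u): c_ij for positive u and c_ji for negative u. It is always multiplied
  by a positive power of the absolute value of u, so its value at 0 plays no role.
\<close>

definition signed_coeff :: "('p \<Rightarrow> 'p \<Rightarrow> real) \<Rightarrow> 'p \<Rightarrow> 'p \<Rightarrow> real \<Rightarrow> real" where
  "signed_coeff c i j u = (if u > 0 then c i j else c j i)"

text \<open>
  Positive definiteness is meant in the non-strict sense customary for covariances: if all
  components of the process coincide, its correlation matrix has all entries 1 and is singular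
  for p > 1.
\<close>

definition nonneg_definite :: "real ^ 'p ^ 'p \<Rightarrow> bool" where
  "nonneg_definite A \<longleftrightarrow> transpose A = A \<and> (\<forall>x. 0 \<le> x \<bullet> (A *v x))"

text \<open>
  Off the diagonal, in the case H_i + H_j \<noteq> 1, the entry is half of c_ij + c_ji. The half comes from
  the factor 1/2 in the covariance formula: at s = t = 1 that formula gives
  E X_i(1) X_j(1) = sigma_i sigma_j (c_ij + c_ji) / 2. Without the half the matrix need not be
  nonnegative definite: for two equal components with H \<noteq> 1/2 one has c_ij + c_ji = 2, and
  the matrix with diagonal entries 1 and off-diagonal entries 2 has determinant -3.
\<close>

definition R_matrix ::
    "real ^ 'p \<Rightarrow> ('p \<Rightarrow> 'p \<Rightarrow> real) \<Rightarrow> ('p \<Rightarrow> 'p \<Rightarrow> real) \<Rightarrow> real ^ 'p ^ 'p" where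
  "R_matrix H c d =
     (\<chi> i j. if i = j then 1
             else if H $ i + H $ j \<noteq> 1 then (c i j + c j i) / 2
             else d i j)"

end

theory Submission
  imports Defs
begin

text \<open>
  Write \<open>G s t\<close> for the cross moment of \<open>X\<^sub>i(s)\<close> and \<open>X\<^sub>j(t)\<close>, and \<open>h = H\<^sub>i + H\<^sub>j\<close>. Only second moments
  enter the theorem, so the process can be forgotten once it is known that \<open>G\<close> vanishes when an argument
  is 0, is homogeneous of degree \<open>h\<close> under positive scaling, and satisfies the identity for
  \<open>G (a - T) (b - T)\<close> that expresses stationarity of the increments. The locale \<open>scaling_kernel\<close>
  collects these properties.

  The symmetric part of \<open>G\<close> is governed by the diagonal: expanding the moment of an increment
  \<open>X(b) - X(a)\<close> expresses \<open>G a b + G b a\<close> through values \<open>G u u\<close>, which are multiples of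
  \<open>\<bar>u\<bar> powr h\<close> (lemma \<open>symmetric_part\<close>). For \<open>i = j\<close> there is nothing else, and this is the
  covariance of fractional Brownian motion.

  The skew part \<open>skew a b = G a b - G b a\<close> is a cohomological object: \<open>\<gamma> x y = skew x (x + y)\<close> is a
  2-cocycle of the additive group of reals, homogeneous of degree \<open>h\<close>. Its commutator
  \<open>\<gamma> x y - \<gamma> y x\<close> is biadditive, hence multiplied by 4 when both arguments are doubled, but also
  multiplied by \<open>2 powr h < 4\<close>; so it vanishes and \<open>\<gamma>\<close> is symmetric. For a symmetric cocycle,
  \<open>2 \<gamma> x y - \<gamma> (2x) (2y)\<close> is the coboundary of \<open>q x = \<gamma> x x\<close> (lemma \<open>coboundary\<close>), and by homogeneity
  this difference is \<open>(2 - 2 powr h) \<gamma> x y\<close>. If \<open>h \<noteq> 1\<close>, division solves for \<open>\<gamma>\<close>, and \<open>q\<close> is a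
  multiple of the odd homogeneous function \<open>sgn u * \<bar>u\<bar> powr h\<close> (lemma \<open>antisymmetric_part\<close>).

  If \<open>h = 1\<close> the factor vanishes, and the cocycle equation becomes the fundamental equation of
  information theory for \<open>\<phi> p = skew p 1\<close> on \<open>(0,1)\<close>. Differentiating it, which is possible by the
  smoothness hypothesis, yields the logarithmic Cauchy equation for \<open>\<phi> p + (1 - p) \<phi>' p\<close>, so \<open>\<phi>\<close> is a
  multiple of the entropy \<open>p ln p + (1 - p) ln (1 - p)\<close> (lemmas \<open>entropy_form\<close> and
  \<open>antisymmetric_part_log\<close>).

  Finally, in both off-diagonal cases the entry of the matrix is the correlation of \<open>X\<^sub>i(1)\<close> and
  \<open>X\<^sub>j(1)\<close>, so the matrix is a Gram matrix.
\<close>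

section \<open>The additive Cauchy equation on the positive half-line\<close>

lemma continuous_additive_on_pos_imp_linear:
  fixes N :: "real \<Rightarrow> real"
  assumes cont: "continuous_on {0<..} N"
    and add: "\<And>x y. 0 < x \<Longrightarrow> 0 < y \<Longrightarrow> N (x + y) = N x + N y"
    and "0 < x"
  shows "N x = x * N 1"
proof (rule ccontr)
  assume neq: "N x \<noteq> x * N 1"
  have mult: "N (of_nat (Suc n) * y) = of_nat (Suc n) * N y" if "0 < y" for n y
  proof (induction n)
    case (Suc n)
    have "N (of_nat (Suc (Suc n)) * y) = N (y + of_nat (Suc n) * y)"
      by (simp add: algebra_simps)
    also have "\<dots> = N y + N (of_nat (Suc n) * y)"
      by (rule add) (use that in \<open>simp_all add: add_pos_nonneg\<close>)
    finally show ?case using Suc by (simp add: algebra_simps)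
  qed simp
  have mult': "N (real n * y) = n * N y" if "0 < y" "0 < n" for n y
    using mult[OF that(1), of "n - 1"] that by simp
  have rat: "N q = q * N 1" if q: "q \<in> \<rat>" "0 < q" for q
  proof -
    obtain m n where mn: "n \<noteq> 0" "\<bar>q\<bar> = real m / real n"
      using Rats_abs_nat_div_natE[OF q(1)] by metis
    then have eq: "q = m / n" using q by simp
    have "0 < m" using eq q by (cases m) auto
    have "n * N q = N (real n * q)" using mult'[of q n] q mn(1) by (simp del: of_nat_eq_0_iff)
    also have "real n * q = real m * 1" using eq mn by simp
    also have "N \<dots> = m * N 1" using mult'[of 1 m] \<open>0 < m\<close> by simp
    finally have "N q = m / n * N 1"
      using mn(1) by (simp add: nonzero_eq_divide_eq mult.commute)
    then show ?thesis using eq by simp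
  qed
  (* The set where N differs from the linear function is open in the half-line, hence contains a
     positive rational as soon as it is nonempty. *)
  have "continuous_on {0<..} (\<lambda>y. N y - y * N 1)"
    using cont by (intro continuous_intros)
  then have "open ({0<..} \<inter> (\<lambda>y. N y - y * N 1) -` (- {0}))"
    by (intro continuous_open_preimage) auto
  moreover have "x \<in> {0<..} \<inter> (\<lambda>y. N y - y * N 1) -` (- {0})"
    using neq assms(3) by simp
  ultimately obtain e where e: "0 < e" "ball x e \<subseteq> {0<..} \<inter> (\<lambda>y. N y - y * N 1) -` (- {0})"
    using open_contains_ball by blast
  obtain q where "q \<in> \<rat>" "x < q" "q < x + e"
    using Rats_dense_in_real[of x "x + e"] e by auto
  then show False using e rat[of q] assms(3) by (auto simp: dist_real_def subset_iff)
qed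

section \<open>Homogeneous kernels of processes with stationary increments\<close>

text \<open>
  The bound \<open>h < 2\<close> separates the degree from that of a bilinear form; the proof that \<open>\<gamma>\<close> is symmetric
  rests on it.
\<close>

locale scaling_kernel =
  fixes G :: "real \<Rightarrow> real \<Rightarrow> real" and h :: real
  assumes h_less_2: "h < 2"
    and zero_left: "G 0 b = 0"
    and zero_right: "G a 0 = 0"
    and shift: "G (a - T) (b - T) = G a b - G a T - G T b + G T T"
    and scale: "0 < r \<Longrightarrow> G (r * a) (r * b) = r powr h * G a b"
begin

text \<open>
  Homogeneity settles positive arguments. A negative argument is reduced to a positive one because
  the increment from \<open>a\<close> to \<open>0\<close> is distributed as the value at \<open>- a\<close>.
\<close>

lemma diagonal: "G a a = \<bar>a\<bar> powr h * G 1 1"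
proof -
  have pos: "G b b = b powr h * G 1 1" if "0 < b" for b
    using scale[OF that, of 1 1] by simp
  show ?thesis
  proof (cases a "0 :: real" rule: linorder_cases)
    case less
    have "G a a = G (- a) (- a)"
      using shift[of 0 a 0] by (simp add: zero_left zero_right)
    also have "\<dots> = \<bar>a\<bar> powr h * G 1 1"
      using pos[of "- a"] less by simp
    finally show ?thesis .
  next
    case equal
    then show ?thesis by (simp add: zero_left)
  next
    case greater
    then show ?thesis using pos[of a] by simp
  qed
qed

text \<open>
  Polarisation: shifting by \<open>a\<close> turns \<open>G (b - a) (b - a)\<close> into an expression whose mixed terms are
  exactly \<open>G a b + G b a\<close>.
\<close>

lemma symmetric_part:
  "G a b + G b a = G 1 1 * (\<bar>a\<bar> powr h + \<bar>b\<bar> powr h - \<bar>b - a\<bar> powr h)"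
proof -
  have "G a b + G b a = G b b + G a a - G (b - a) (b - a)"
    using shift[of b a b] by simp
  then show ?thesis
    by (simp add: diagonal[of a] diagonal[of b] diagonal[of "b - a"] algebra_simps)
qed

definition skew :: "real \<Rightarrow> real \<Rightarrow> real" where
  "skew a b = G a b - G b a"

lemma skew_antisym: "skew b a = - skew a b"
  by (simp add: skew_def)

lemma skew_zero [simp]: "skew 0 b = 0" "skew a 0 = 0"
  by (simp_all add: skew_def zero_left zero_right)

text \<open>
  In \<open>shift\<close> minus its copy with \<open>a\<close> and \<open>b\<close> exchanged, \<open>G T T\<close> cancels and the other terms pair up
  to a cyclic sum over the triangle \<open>a\<close>, \<open>b\<close>, \<open>T\<close>.
\<close>

lemma skew_shift: "skew (a - T) (b - T) = skew a b + skew b T + skew T a"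
  using shift[of a T b] shift[of b T a] by (simp add: skew_def)

lemma skew_scale: "0 < r \<Longrightarrow> skew (r * a) (r * b) = r powr h * skew a b"
  by (simp add: skew_def scale right_diff_distrib)

lemma symmetric_plus_skew:
  "2 * G a b = G 1 1 * (\<bar>a\<bar> powr h + \<bar>b\<bar> powr h - \<bar>b - a\<bar> powr h) + skew a b"
  using symmetric_part[of a b] by (simp add: skew_def)

text \<open>
  The cyclic sum in \<open>skew_shift\<close> is a translation invariant function of three points. In the bar
  notation of group cohomology, where a triangle is recorded by its consecutive increments \<open>x\<close> and
  \<open>y\<close>, it is the following inhomogeneous 2-cochain, and \<open>skew_shift\<close> becomes the cocycle identity.
\<close>

definition \<gamma> :: "real \<Rightarrow> real \<Rightarrow> real" where
  "\<gamma> x y = skew x (x + y)"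

lemma cocycle: "\<gamma> x y + \<gamma> (x + y) z = \<gamma> y z + \<gamma> x (y + z)"
  using skew_shift[of "x + y" x "x + y + z"] skew_antisym[of x "x + y + z"]
  by (simp add: \<gamma>_def add.assoc)

lemma \<gamma>_scale: "0 < r \<Longrightarrow> \<gamma> (r * x) (r * y) = r powr h * \<gamma> x y"
  using skew_scale[of r x "x + y"] by (simp add: \<gamma>_def distrib_left)

text \<open>
  The commutator of a 2-cocycle of an abelian group is biadditive. Doubling both arguments therefore
  multiplies it by 4, whereas homogeneity gives the factor \<open>2 powr h\<close>, which is smaller.
\<close>

lemma \<gamma>_commute: "\<gamma> x y = \<gamma> y x"
proof -
  define \<beta> where "\<beta> x y = \<gamma> x y - \<gamma> y x" for x y
  have add_left: "\<beta> (x + y) z = \<beta> x z + \<beta> y z" for x y z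
    using cocycle[of x y z] cocycle[of z x y] cocycle[of x z y]
    by (simp add: \<beta>_def add.commute)
  have add_right: "\<beta> x (y + z) = \<beta> x y + \<beta> x z" for x y z
    using add_left[of y z x] by (simp add: \<beta>_def)
  have "\<beta> (2 * x) (2 * y) = 4 * \<beta> x y"
    using add_left[of x x] add_right[of _ y y] by simp
  moreover have "\<beta> (2 * x) (2 * y) = 2 powr h * \<beta> x y"
    by (simp add: \<beta>_def \<gamma>_scale right_diff_distrib)
  moreover have "2 powr h < (4 :: real)"
    using powr_less_mono[OF h_less_2, of 2] by simp
  ultimately have "\<beta> x y = 0" by simp
  then show ?thesis by (simp add: \<beta>_def)
qed

text \<open>
  On the diagonal only one degree of freedom per sign remains, and the shift identity makes the
  diagonal odd, so that a single constant survives.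
\<close>

lemma \<gamma>_diagonal: "\<gamma> x x = sgn x * \<bar>x\<bar> powr h * skew 1 2"
proof -
  have pos: "\<gamma> y y = y powr h * skew 1 2" if "0 < y" for y
    using \<gamma>_scale[OF that, of 1 1] by (simp add: \<gamma>_def)
  show ?thesis
  proof (cases x "0 :: real" rule: linorder_cases)
    case less
    have "skew x (2 * x) = skew (- x + 2 * x) (0 + 2 * x)"
      by simp
    also have "\<dots> = - skew (- x) (- x + - x)"
      using skew_shift[of "- x" "- 2 * x" 0] skew_antisym[of "- x" "- 2 * x"] by simp
    finally have "\<gamma> x x = - \<gamma> (- x) (- x)"
      by (simp add: \<gamma>_def)
    also have "\<dots> = sgn x * \<bar>x\<bar> powr h * skew 1 2"
      using pos[of "- x"] less by simp
    finally show ?thesis .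
  qed (use pos[of x] in \<open>simp_all add: \<gamma>_def\<close>)
qed

text \<open>
  If \<open>\<gamma>\<close> is the coboundary of \<open>g\<close>, then \<open>\<gamma> x x = 2 g x - g (2x)\<close>, whose coboundary is
  \<open>2 \<gamma> x y - \<gamma> (2x) (2y)\<close>. The latter identity follows from three instances of the cocycle identity and
  symmetry, without a primitive \<open>g\<close> being given; homogeneity then turns doubling into a scalar.
\<close>

lemma coboundary: "\<gamma> x x + \<gamma> y y - \<gamma> (x + y) (x + y) = (2 - 2 powr h) * \<gamma> x y"
proof -
  have "\<gamma> (2 * x) (2 * y) = 2 powr h * \<gamma> x y"
    by (simp add: \<gamma>_scale)
  moreover have "\<gamma> (x + y) y = \<gamma> y (x + y)"
    by (rule \<gamma>_commute)
  ultimately show ?thesis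
    using cocycle[of x y "x + y"] cocycle[of x x "2 * y"] cocycle[of x y y]
    by (simp add: algebra_simps)
qed

text \<open>
  Since \<open>h \<noteq> 1\<close>, the factor in \<open>coboundary\<close> can be divided out; \<open>s\<close> and \<open>t - s\<close> are the increments
  that encode \<open>skew s t\<close>.
\<close>

lemma antisymmetric_part:
  assumes "h \<noteq> 1"
  shows "skew s t = skew 1 2 / (2 - 2 powr h) *
    (sgn s * \<bar>s\<bar> powr h - sgn t * \<bar>t\<bar> powr h + sgn (t - s) * \<bar>t - s\<bar> powr h)"
proof -
  have "2 powr h \<noteq> (2 :: real)"
    using assms powr_inj[of 2 h 1] by simp
  then show ?thesis
    using coboundary[of s "t - s"]
    by (simp add: \<gamma>_diagonal \<gamma>_def[of s] field_simps)
qed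

section \<open>The skew part in degree one\<close>

text \<open>
  In degree one, \<open>\<gamma> x y = (x + y) \<phi> (x / (x + y))\<close>, and the partial derivative of \<open>\<gamma>\<close> in its first
  argument is a function \<open>M\<close> of \<open>p = x / (x + y)\<close> alone. Differentiating the cocycle identity in \<open>x\<close>
  removes the term \<open>\<gamma> y z\<close> and leaves three values of \<open>M\<close>, at ratios of which one is the product of the
  other two. Hence \<open>M\<close> is a multiple of the logarithm. To return to \<open>\<phi>\<close>, the symmetry
  \<open>\<phi> (1 - p) = \<phi> p\<close> and Euler's identity for the homogeneous function \<open>\<gamma>\<close> give
  \<open>\<phi> p = p M p + (1 - p) M (1 - p)\<close>.
\<close>

lemma entropy_form:
  assumes h1: "h = 1"
    and C1: "(\<lambda>t. skew t 1) C1_differentiable_on {0<..<1}"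
  shows "\<exists>c. \<forall>s t. 0 < s \<longrightarrow> s < t \<longrightarrow>
    skew s t = c * (t * ln t - s * ln s - (t - s) * ln (t - s))"
proof -
  define \<phi> where "\<phi> t = skew t 1" for t
  from C1 obtain D where
    D: "\<And>p. p \<in> {0<..<1} \<Longrightarrow> (\<phi> has_real_derivative D p) (at p)"
    and contD: "continuous_on {0<..<1} D"
    unfolding C1_differentiable_on_def \<phi>_def has_real_derivative_iff_has_vector_derivative by blast
  have \<gamma>_eq: "\<gamma> x y = (x + y) * \<phi> (x / (x + y))" if "0 < x + y" for x y
    using skew_scale[OF that, of "x / (x + y)" 1] that by (simp add: \<gamma>_def \<phi>_def h1)
  define M where "M p = \<phi> p + (1 - p) * D p" for p
  have dM: "((\<lambda>x. \<gamma> x y) has_real_derivative M (x / (x + y))) (at x)" if "0 < x" "0 < y" for x y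
  proof -
    have p: "x / (x + y) \<in> {0<..<1}" using that by simp
    have "((\<lambda>x. x / (x + y)) has_real_derivative y / (x + y)\<^sup>2) (at x)"
      using that by (auto intro!: derivative_eq_intros simp: power2_eq_square field_simps)
    from DERIV_chain2[OF D[OF p] this]
    have "((\<lambda>x. \<phi> (x / (x + y))) has_real_derivative D (x / (x + y)) * (y / (x + y)\<^sup>2)) (at x)" .
    moreover have "((\<lambda>x. x + y) has_real_derivative 1) (at x)"
      by (auto intro!: derivative_eq_intros)
    ultimately have "((\<lambda>x. (x + y) * \<phi> (x / (x + y))) has_real_derivative
        1 * \<phi> (x / (x + y)) + D (x / (x + y)) * (y / (x + y)\<^sup>2) * (x + y)) (at x)"
      by (intro DERIV_mult)
    moreover have "1 * \<phi> (x / (x + y)) + D (x / (x + y)) * (y / (x + y)\<^sup>2) * (x + y) =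
        M (x / (x + y))"
    proof -
      have ne: "x + y \<noteq> 0" using that by simp
      have "y / (x + y)\<^sup>2 * (x + y) = y / (x + y)"
        using ne by (simp add: power2_eq_square)
      also have "\<dots> = 1 - x / (x + y)"
        using ne by (simp add: field_simps)
      finally have "D (x / (x + y)) * (y / (x + y)\<^sup>2 * (x + y)) = D (x / (x + y)) * (1 - x / (x + y))"
        by (rule arg_cong)
      then show ?thesis by (simp only: M_def mult.assoc) simp
    qed
    ultimately have "((\<lambda>x. (x + y) * \<phi> (x / (x + y))) has_real_derivative M (x / (x + y))) (at x)"
      by simp
    moreover have "\<forall>\<^sub>F x in nhds x. (x + y) * \<phi> (x / (x + y)) = \<gamma> x y"
    proof -
      have "\<forall>\<^sub>F x in nhds x. x \<in> {0<..}"
        using that by (intro eventually_nhds_in_open) auto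
      then show ?thesis by eventually_elim (use \<gamma>_eq that in simp)
    qed
    ultimately show ?thesis by (subst (asm) DERIV_cong_ev) auto
  qed
  have M_mult: "M (p * q) = M p + M q" if "p \<in> {0<..<1}" "q \<in> {0<..<1}" for p q
  proof -
    (* The triple with total 1 in which x is the fraction p of x + y and x + y is the fraction q of
       the total. *)
    define x y z where "x = p * q" and "y = q * (1 - p)" and "z = 1 - q"
    have pos: "0 < x" "0 < y" "0 < z" using that by (auto simp: x_def y_def z_def)
    have xy: "x + y = q" by (simp add: x_def y_def algebra_simps)
    have d1: "((\<lambda>x. \<gamma> (x + y) z) has_real_derivative M ((x + y) / (x + y + z)) * 1) (at x)"
      by (rule DERIV_chain2[OF dM]) (use pos in \<open>auto intro!: derivative_eq_intros\<close>)
    have "((\<lambda>x. \<gamma> x y + \<gamma> (x + y) z) has_real_derivative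
        M (x / (x + y)) + M ((x + y) / (x + y + z))) (at x)"
      using DERIV_add[OF dM[OF pos(1,2)] d1] by simp
    moreover have "((\<lambda>x. \<gamma> y z + \<gamma> x (y + z)) has_real_derivative
        0 + M (x / (x + (y + z)))) (at x)"
      by (intro DERIV_add DERIV_const dM) (use pos in auto)
    ultimately have "M (x / (x + y)) + M ((x + y) / (x + y + z)) = M (x / (x + (y + z)))"
      unfolding cocycle using DERIV_unique by fastforce
    moreover have "x / (x + y) = p" "(x + y) / (x + y + z) = q" "x / (x + (y + z)) = p * q"
      using that xy by (simp_all add: x_def z_def add.assoc[symmetric])
    ultimately show ?thesis by simp
  qed
  have contM: "continuous_on {0<..<1} M"
  proof -
    have "continuous_on {0<..<1} \<phi>"
      using D by (meson DERIV_continuous_on has_field_derivative_at_within)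
    then show ?thesis unfolding M_def using contD by (intro continuous_intros)
  qed
  define c where "c = - M (exp (- 1))"
  have M_ln: "M p = c * ln p" if "p \<in> {0<..<1}" for p
  proof -
    (* The substitution p = exp (- x) turns products in (0,1) into sums of positive reals. *)
    have "M (exp (- x)) = x * M (exp (- 1))" if "0 < x" for x
    proof (rule continuous_additive_on_pos_imp_linear[where N = "\<lambda>x. M (exp (- x))"])
      show "continuous_on {0<..} (\<lambda>x. M (exp (- x)))"
        by (rule continuous_on_compose2[OF contM]) (auto intro!: continuous_intros)
      show "M (exp (- (x + y))) = M (exp (- x)) + M (exp (- y))" if "0 < x" "0 < y" for x y
        using M_mult[of "exp (- x)" "exp (- y)"] that by (simp add: exp_add[symmetric])
    qed fact
    from this[of "- ln p"] that show ?thesis by (simp add: c_def)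
  qed
  have \<phi>_sym: "\<phi> (1 - p) = \<phi> p" for p
    using \<gamma>_commute[of "1 - p" p] \<gamma>_eq[of "1 - p" p] \<gamma>_eq[of p "1 - p"] by simp
  have D_sym: "D (1 - p) = - D p" if "p \<in> {0<..<1}" for p
  proof -
    have "((\<lambda>p. \<phi> (1 - p)) has_real_derivative D (1 - p) * (- 1)) (at p)"
      by (rule DERIV_chain2[OF D]) (use that in \<open>auto intro!: derivative_eq_intros\<close>)
    then show ?thesis
      using DERIV_unique[OF _ D[OF that]] unfolding \<phi>_sym by fastforce
  qed
  have \<phi>_eq: "\<phi> p = c * (p * ln p + (1 - p) * ln (1 - p))" if "p \<in> {0<..<1}" for p
  proof -
    have "\<phi> p = p * M p + (1 - p) * M (1 - p)"
      using that by (simp add: M_def \<phi>_sym D_sym algebra_simps)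
    then show ?thesis using that by (simp add: M_ln algebra_simps)
  qed
  have "skew s t = - c * (t * ln t - s * ln s - (t - s) * ln (t - s))" if "0 < s" "s < t" for s t
  proof -
    have "skew s t = t * \<phi> (s / t)"
      using \<gamma>_eq[of s "t - s"] that by (simp add: \<gamma>_def)
    also have "\<dots> = c * (s * ln (s / t) + (t - s) * ln ((t - s) / t))"
      using that \<phi>_eq[of "s / t"] by (simp add: field_simps)
    finally show ?thesis using that by (simp add: ln_div algebra_simps)
  qed
  then show ?thesis by blast
qed

text \<open>
  The formula is extended from \<open>0 < s < t\<close> to the plane: both sides change sign when \<open>s\<close> and \<open>t\<close> are
  exchanged, and both are unchanged when \<open>(s, t)\<close> is replaced by \<open>(t - s, - s)\<close>, which moves a
  negative \<open>s\<close> with \<open>s \<le> t\<close> to the closed positive quadrant.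
\<close>

lemma antisymmetric_part_log:
  assumes "h = 1"
    and "(\<lambda>t. skew t 1) C1_differentiable_on {0<..<1}"
  shows "\<exists>c. \<forall>s t. skew s t =
    c * (t * ln \<bar>t\<bar> - s * ln \<bar>s\<bar> - (t - s) * ln \<bar>t - s\<bar>)"
proof -
  from entropy_form[OF assms] obtain c where
    c: "\<And>s t. 0 < s \<Longrightarrow> s < t \<Longrightarrow> skew s t = c * (t * ln t - s * ln s - (t - s) * ln (t - s))"
    by blast
  define E where "E s t = c * (t * ln \<bar>t\<bar> - s * ln \<bar>s\<bar> - (t - s) * ln \<bar>t - s\<bar>)" for s t
  have E_antisym: "E t s = - E s t" for s t
    by (simp add: E_def abs_minus_commute[of s t] algebra_simps)
  have quadrant: "skew s t = E s t" if "0 \<le> s" "0 \<le> t" for s t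
  proof -
    have less: "skew s t = E s t" if "0 \<le> s" "s < t" for s t
      using that c[of s t] by (cases "s = 0") (simp_all add: E_def)
    show ?thesis
    proof (cases s t rule: linorder_cases)
      case equal
      then show ?thesis using skew_antisym[of s s] by (simp add: E_def)
    next
      case greater
      then show ?thesis using less[of t s] that skew_antisym[of s t] E_antisym[of s t] by simp
    qed (use less that in simp)
  qed
  have ordered: "skew s t = E s t" if "s \<le> t" for s t
  proof (cases "0 \<le> s")
    case False
    have "skew s t = skew (t - s) (- s)"
      using skew_shift[of 0 "- s" "t - s"] by simp
    also have "\<dots> = E (t - s) (- s)"
      using False that by (intro quadrant) auto
    also have "\<dots> = E s t"
      by (simp add: E_def algebra_simps)
    finally show ?thesis .
  qed (use quadrant that in simp)
  have "skew s t = E s t" for s t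
    using ordered[of s t] ordered[of t s] skew_antisym[of s t] E_antisym[of s t]
    by (cases "s \<le> t") auto
  then show ?thesis unfolding E_def by blast
qed

end

section \<open>Second moments of the process\<close>

text \<open>
  The product of two coordinates is a measurable function of the values at the two times \<open>s\<close> and \<open>t\<close>,
  so its expectation is determined by a two-dimensional marginal law.
\<close>

lemma fdd_eq_imp_product_moment_eq:
  fixes X Y :: "'t \<Rightarrow> 'a \<Rightarrow> real ^ 'p"
  assumes eq: "fdd_eq M X Y"
    and [measurable]: "\<And>t. X t \<in> borel_measurable M" "\<And>t. Y t \<in> borel_measurable M"
  shows "(LINT \<omega>|M. X s \<omega> $ i * X t \<omega> $ j) = (LINT \<omega>|M. Y s \<omega> $ i * Y t \<omega> $ j)"
proof -
  let ?P = "\<Pi>\<^sub>M u\<in>{s, t}. (borel :: (real ^ 'p) measure)"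
  let ?g = "\<lambda>w. w s $ i * w t $ j"
  have nth: "(\<lambda>v :: real ^ 'p. v $ k) \<in> borel_measurable borel" for k
    by (intro borel_measurable_continuous_onI continuous_intros)
  have coord: "(\<lambda>w. w u $ k) \<in> borel_measurable ?P" if "u \<in> {s, t}" for u k
    by (rule measurable_compose[OF measurable_component_singleton[OF that] nth])
  have g: "?g \<in> borel_measurable ?P"
    by (intro borel_measurable_times coord) auto
  have law: "(LINT \<omega>|M. Z s \<omega> $ i * Z t \<omega> $ j) =
      (LINT w|distr M ?P (\<lambda>\<omega>. \<lambda>u\<in>{s, t}. Z u \<omega>). ?g w)"
    if "\<And>t. Z t \<in> borel_measurable M" for Z
  proof -
    have "(\<lambda>\<omega>. \<lambda>u\<in>{s, t}. Z u \<omega>) \<in> measurable M ?P"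
      using that by (intro measurable_restrict) auto
    from integral_distr[OF this g] show ?thesis by simp
  qed
  have "distr M ?P (\<lambda>\<omega>. \<lambda>u\<in>{s, t}. X u \<omega>) = distr M ?P (\<lambda>\<omega>. \<lambda>u\<in>{s, t}. Y u \<omega>)"
    using eq unfolding fdd_eq_def by simp
  then show ?thesis using law[of X] law[of Y] by simp
qed

lemma integrable_product_of_squares:
  fixes U V :: "'a \<Rightarrow> real"
  assumes [measurable]: "U \<in> borel_measurable M" "V \<in> borel_measurable M"
    and "integrable M (\<lambda>\<omega>. (U \<omega>)\<^sup>2)" "integrable M (\<lambda>\<omega>. (V \<omega>)\<^sup>2)"
  shows "integrable M (\<lambda>\<omega>. U \<omega> * V \<omega>)"
proof (rule Bochner_Integration.integrable_bound)
  show "integrable M (\<lambda>\<omega>. (U \<omega>)\<^sup>2 + (V \<omega>)\<^sup>2)"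
    using assms by simp
  have "\<bar>u * v\<bar> \<le> u\<^sup>2 + v\<^sup>2" for u v :: real
  proof -
    have "2 * \<bar>u * v\<bar> \<le> u\<^sup>2 + v\<^sup>2"
      using sum_squares_bound[of "\<bar>u\<bar>" "\<bar>v\<bar>"] by (simp add: abs_mult)
    then show ?thesis using abs_ge_zero[of "u * v"] by linarith
  qed
  then show "AE \<omega> in M. norm (U \<omega> * V \<omega>) \<le> norm ((U \<omega>)\<^sup>2 + (V \<omega>)\<^sup>2)"
    by simp
qed measurable

text \<open>
  Since \<open>X 0 = 0\<close> almost surely, the value at \<open>a - T\<close> is an increment from 0, distributed jointly with
  the one at \<open>b - T\<close> as the increments of \<open>X\<close> from \<open>T\<close> to \<open>a\<close> and to \<open>b\<close>. Finite second moments allow the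
  product of these to be expanded.
\<close>

lemma cross_moment_increments:
  fixes X :: "real \<Rightarrow> 'a \<Rightarrow> real ^ 'p"
  assumes X: "\<And>t. X t \<in> borel_measurable M"
    and sq: "\<And>t i. integrable M (\<lambda>\<omega>. (X t \<omega> $ i)\<^sup>2)"
    and si: "stationary_increments M X"
    and zero: "AE \<omega> in M. X 0 \<omega> = 0"
  defines "G \<equiv> \<lambda>i j s t. LINT \<omega>|M. X s \<omega> $ i * X t \<omega> $ j"
  shows "G i j (a - T) (b - T) = G i j a b - G i j a T - G i j T b + G i j T T"
proof -
  note [measurable] = X
  have nth: "(\<lambda>v :: real ^ 'p. v $ k) \<in> borel_measurable borel" for k
    by (intro borel_measurable_continuous_onI continuous_intros)
  have coord: "(\<lambda>\<omega>. X t \<omega> $ k) \<in> borel_measurable M" for t k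
    using measurable_compose[OF X nth] .
  note int = integrable_product_of_squares[OF coord coord sq sq]
  have "G i j (a - T) (b - T) =
      (LINT \<omega>|M. (X (a - T) \<omega> - X 0 \<omega>) $ i * (X (b - T) \<omega> - X 0 \<omega>) $ j)"
    unfolding G_def
  proof (rule integral_cong_AE)
    show "AE \<omega> in M. X (a - T) \<omega> $ i * X (b - T) \<omega> $ j =
        (X (a - T) \<omega> - X 0 \<omega>) $ i * (X (b - T) \<omega> - X 0 \<omega>) $ j"
      using zero by eventually_elim simp
  qed (use coord in \<open>auto intro!: borel_measurable_times borel_measurable_diff\<close>)
  also have "\<dots> = (LINT \<omega>|M. (X (a - T + T) \<omega> - X T \<omega>) $ i * (X (b - T + T) \<omega> - X T \<omega>) $ j)"
    using si unfolding stationary_increments_def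
    by (intro fdd_eq_imp_product_moment_eq[symmetric]) auto
  also have "\<dots> = (LINT \<omega>|M. X a \<omega> $ i * X b \<omega> $ j - X a \<omega> $ i * X T \<omega> $ j
      - X T \<omega> $ i * X b \<omega> $ j + X T \<omega> $ i * X T \<omega> $ j)"
    by (simp add: algebra_simps)
  also have "\<dots> = G i j a b - G i j a T - G i j T b + G i j T T"
    unfolding G_def by (simp add: int)
  finally show ?thesis .
qed

lemma cross_moment_scaling:
  fixes X :: "real \<Rightarrow> 'a \<Rightarrow> real ^ 'p"
  assumes X: "\<And>t. X t \<in> borel_measurable M"
    and ss: "vector_self_similar M H X"
    and "0 < r"
  shows "(LINT \<omega>|M. X (r * s) \<omega> $ i * X (r * t) \<omega> $ j) =
    r powr (H $ i + H $ j) * (LINT \<omega>|M. X s \<omega> $ i * X t \<omega> $ j)"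
proof -
  have "(\<lambda>v :: real ^ 'p. \<chi> i. r powr (H $ i) * v $ i) \<in> borel_measurable borel"
    by (intro borel_measurable_continuous_onI continuous_intros)
  from measurable_compose[OF X this]
  have meas: "(\<lambda>\<omega>. \<chi> i. r powr (H $ i) * X t \<omega> $ i) \<in> borel_measurable M" for t .
  have "(LINT \<omega>|M. X (r * s) \<omega> $ i * X (r * t) \<omega> $ j) =
      (LINT \<omega>|M. (\<chi> i. r powr (H $ i) * X s \<omega> $ i) $ i * (\<chi> i. r powr (H $ i) * X t \<omega> $ i) $ j)"
    using ss \<open>0 < r\<close> unfolding vector_self_similar_def
    by (intro fdd_eq_imp_product_moment_eq[where X = "\<lambda>t. X (r * t)" and
        Y = "\<lambda>t \<omega>. \<chi> i. r powr (H $ i) * X t \<omega> $ i"] X meas) auto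
  also have "\<dots> = (LINT \<omega>|M. r powr (H $ i + H $ j) * (X s \<omega> $ i * X t \<omega> $ j))"
    by (simp add: powr_add mult_ac)
  finally show ?thesis by simp
qed

text \<open>The quadratic form at \<open>x\<close> is the integral of the square of \<open>\<Sum>i. x $ i * Z i\<close>.\<close>

lemma nonneg_definite_Gram:
  fixes Z :: "'p :: finite \<Rightarrow> 'a \<Rightarrow> real"
  assumes int: "\<And>i j. integrable M (\<lambda>\<omega>. Z i \<omega> * Z j \<omega>)"
  shows "nonneg_definite (\<chi> i j. LINT \<omega>|M. Z i \<omega> * Z j \<omega>)"
  unfolding nonneg_definite_def
proof (intro conjI allI)
  show "transpose (\<chi> i j. LINT \<omega>|M. Z i \<omega> * Z j \<omega>) = (\<chi> i j. LINT \<omega>|M. Z i \<omega> * Z j \<omega>)"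
    by (simp add: transpose_def mult.commute)
  fix x :: "real ^ 'p"
  have "x \<bullet> ((\<chi> i j. LINT \<omega>|M. Z i \<omega> * Z j \<omega>) *v x) =
      (\<Sum>i\<in>UNIV. \<Sum>j\<in>UNIV. LINT \<omega>|M. x $ i * x $ j * (Z i \<omega> * Z j \<omega>))"
    by (simp add: inner_vec_def matrix_vector_mult_def sum_distrib_left mult_ac)
  also have "\<dots> = (LINT \<omega>|M. (\<Sum>i\<in>UNIV. \<Sum>j\<in>UNIV. x $ i * x $ j * (Z i \<omega> * Z j \<omega>)))"
    using int by (simp add: Bochner_Integration.integral_sum)
  also have "\<dots> = (LINT \<omega>|M. (\<Sum>i\<in>UNIV. x $ i * Z i \<omega>)\<^sup>2)"
    by (simp add: power2_eq_square sum_product mult_ac)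
  also have "\<dots> \<ge> 0" by simp
  finally show "0 \<le> x \<bullet> ((\<chi> i j. LINT \<omega>|M. Z i \<omega> * Z j \<omega>) *v x)" .
qed

section \<open>The covariance of a vector self-similar process with stationary increments\<close>

theorem theorem2p1:
  fixes M :: "'a measure"
    and X :: "real \<Rightarrow> 'a \<Rightarrow> real ^ 'p"
    and H \<sigma> :: "real ^ 'p"
  assumes "prob_space M"
    and "\<And>t. X t \<in> borel_measurable M"
    and "\<And>t i. integrable M (\<lambda>\<omega>. (X t \<omega> $ i)\<^sup>2)"
    and "stationary_increments M X"
    and "\<And>t i. (LINT \<omega>|M. X t \<omega> $ i) = 0"
    and "AE \<omega> in M. X 0 \<omega> = 0"
    and "\<And>i. 0 < H $ i \<and> H $ i < 1"
    and "vector_self_similar M H X"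
    and "\<And>i j. (\<lambda>t. LINT \<omega>|M. X t \<omega> $ i * X 1 \<omega> $ j) C1_differentiable_on ({0<..<1} \<union> {1<..})"
    and "\<And>i. \<sigma> $ i > 0"
    and "\<And>i. prob_space.variance M (\<lambda>\<omega>. X 1 \<omega> $ i) = (\<sigma> $ i)\<^sup>2"
  shows "\<exists>c d f :: 'p \<Rightarrow> 'p \<Rightarrow> real.
    (\<forall>i s t. (LINT \<omega>|M. X s \<omega> $ i * X t \<omega> $ i) =
        (\<sigma> $ i)\<^sup>2 / 2 *
          (\<bar>s\<bar> powr (2 * H $ i) + \<bar>t\<bar> powr (2 * H $ i) - \<bar>t - s\<bar> powr (2 * H $ i)))
    \<and> (\<forall>i j. i \<noteq> j \<and> H $ i + H $ j \<noteq> 1 \<longrightarrow> (\<forall>s t.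
        covariance M (\<lambda>\<omega>. X s \<omega> $ i) (\<lambda>\<omega>. X t \<omega> $ j) = (LINT \<omega>|M. X s \<omega> $ i * X t \<omega> $ j)
        \<and> (LINT \<omega>|M. X s \<omega> $ i * X t \<omega> $ j) =
            \<sigma> $ i * \<sigma> $ j / 2 *
              (signed_coeff c i j s * \<bar>s\<bar> powr (H $ i + H $ j)
               + signed_coeff c j i t * \<bar>t\<bar> powr (H $ i + H $ j)
               - signed_coeff c j i (t - s) * \<bar>t - s\<bar> powr (H $ i + H $ j))))
    \<and> (\<forall>i j. i \<noteq> j \<and> H $ i + H $ j = 1 \<longrightarrow> (\<forall>s t.
        (LINT \<omega>|M. X s \<omega> $ i * X t \<omega> $ j) =
            \<sigma> $ i * \<sigma> $ j / 2 *
              (d i j * (\<bar>s\<bar> + \<bar>t\<bar> - \<bar>s - t\<bar>)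
               + f i j * (t * ln \<bar>t\<bar> - s * ln \<bar>s\<bar> - (t - s) * ln \<bar>t - s\<bar>))))
    \<and> nonneg_definite (R_matrix H c d)"
proof -
  interpret prob_space M by fact
  note X = assms(2) and sq = assms(3)
  have coord: "(\<lambda>\<omega>. X t \<omega> $ k) \<in> borel_measurable M" for t k
  proof (rule measurable_compose[OF X])
    show "(\<lambda>v :: real ^ 'p. v $ k) \<in> borel_measurable borel"
      by (intro borel_measurable_continuous_onI continuous_intros)
  qed
  note int = integrable_product_of_squares[OF coord coord sq sq]

  define G where "G i j s t = (LINT \<omega>|M. X s \<omega> $ i * X t \<omega> $ j)" for i j s t
  have flip: "G j i t s = G i j s t" for i j s t
    by (simp add: G_def mult.commute)
  have kernel: "scaling_kernel (G i j) (H $ i + H $ j)" for i j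
  proof
    show "H $ i + H $ j < 2"
      using assms(7)[of i] assms(7)[of j] by auto
    have vanish: "G i j 0 b = 0" for i j b
      unfolding G_def by (rule integral_eq_zero_AE) (use assms(6) in \<open>eventually_elim, simp\<close>)
    show "G i j 0 b = 0" for b by (rule vanish)
    show "G i j a 0 = 0" for a using vanish[of j i a] flip[of j i 0 a] by simp
    show "G i j (a - T) (b - T) = G i j a b - G i j a T - G i j T b + G i j T T" for a b T
      unfolding G_def by (rule cross_moment_increments[OF X sq assms(4,6)])
    show "G i j (r * a) (r * b) = r powr (H $ i + H $ j) * G i j a b" if "0 < r" for r a b
      unfolding G_def by (rule cross_moment_scaling[OF X assms(8) that])
  qed

  define K where "K i j = scaling_kernel.skew (G i j)" for i j
  have K_eq: "K i j s t = G i j s t - G i j t s" for i j s t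
    unfolding K_def by (rule scaling_kernel.skew_def[OF kernel])
  have K_swap: "K j i s t = - K i j s t" for i j s t
    using flip[of j i s t] flip[of j i t s] by (simp add: K_eq)
  define \<rho> where "\<rho> i j = G i j 1 1" for i j
  have \<rho>_swap: "\<rho> j i = \<rho> i j" for i j
    by (simp add: \<rho>_def flip)
  have G_eq: "2 * G i j s t = \<rho> i j * (\<bar>s\<bar> powr (H $ i + H $ j) + \<bar>t\<bar> powr (H $ i + H $ j)
      - \<bar>t - s\<bar> powr (H $ i + H $ j)) + K i j s t" for i j s t
    unfolding \<rho>_def K_def by (rule scaling_kernel.symmetric_plus_skew[OF kernel])
  have \<rho>_diag: "\<rho> i i = (\<sigma> $ i)\<^sup>2" for i
    using assms(11)[of i] by (simp add: \<rho>_def G_def assms(5) power2_eq_square)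
  have \<sigma>_pos: "0 < \<sigma> $ i" for i by (rule assms(10))
  then have \<sigma>_nz: "\<sigma> $ i \<noteq> 0" for i by (metis less_irrefl)

  define \<kappa> where "\<kappa> i j = K i j 1 2 / (2 - 2 powr (H $ i + H $ j))" for i j
  have \<kappa>_swap: "\<kappa> j i = - \<kappa> i j" for i j
    by (simp add: \<kappa>_def K_swap[of j i] add.commute)
  have "\<exists>e. H $ i + H $ j = 1 \<longrightarrow> (\<forall>s t. K i j s t =
      e * (t * ln \<bar>t\<bar> - s * ln \<bar>s\<bar> - (t - s) * ln \<bar>t - s\<bar>))" for i j
  proof (cases "H $ i + H $ j = 1")
    case True
    have "(\<lambda>t. G i j t 1 - G j i t 1) C1_differentiable_on ({0<..<1} \<union> {1<..})"
      unfolding G_def by (intro C1_differentiable_on_diff assms(9))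
    then have "(\<lambda>t. K i j t 1) C1_differentiable_on {0<..<1}"
      unfolding K_eq flip[of i j 1] by (rule C1_differentiable_on_subset) auto
    then show ?thesis
      using scaling_kernel.antisymmetric_part_log[OF kernel True] unfolding K_def by blast
  qed simp
  then obtain e where e: "\<And>i j s t. H $ i + H $ j = 1 \<Longrightarrow> K i j s t =
      e i j * (t * ln \<bar>t\<bar> - s * ln \<bar>s\<bar> - (t - s) * ln \<bar>t - s\<bar>)"
    by metis

  (* Exchanging i and j fixes \<rho> and changes the sign of \<kappa>. So the sum and the difference of the symmetric
     and the skew coefficient are the numerators of c i j and c j i, the coefficients on the two
     half-lines. *)
  define c where "c i j = (\<rho> i j + \<kappa> i j) / (\<sigma> $ i * \<sigma> $ j)" for i j
  define d where "d i j = \<rho> i j / (\<sigma> $ i * \<sigma> $ j)" for i j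
  define f where "f i j = e i j / (\<sigma> $ i * \<sigma> $ j)" for i j

  have half: "g = x / 2 * y" if "2 * g = x * y" for g x y :: real
    using that by simp
  have "G i i s t = (\<sigma> $ i)\<^sup>2 / 2 *
      (\<bar>s\<bar> powr (2 * H $ i) + \<bar>t\<bar> powr (2 * H $ i) - \<bar>t - s\<bar> powr (2 * H $ i))" for i s t
  proof -
    have "K i i s t = 0" using K_swap[of i i s t] by simp
    then have "2 * G i i s t = (\<sigma> $ i)\<^sup>2 *
        (\<bar>s\<bar> powr (2 * H $ i) + \<bar>t\<bar> powr (2 * H $ i) - \<bar>t - s\<bar> powr (2 * H $ i))"
      using G_eq[of i i s t] by (simp add: \<rho>_diag flip: mult_2)
    then show ?thesis by (rule half)
  qed
  moreover have "covariance M (\<lambda>\<omega>. X s \<omega> $ i) (\<lambda>\<omega>. X t \<omega> $ j) = G i j s t" for i j s t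
    by (simp add: covariance_def assms(5) G_def)
  moreover have "G i j s t = \<sigma> $ i * \<sigma> $ j / 2 *
      (signed_coeff c i j s * \<bar>s\<bar> powr (H $ i + H $ j)
       + signed_coeff c j i t * \<bar>t\<bar> powr (H $ i + H $ j)
       - signed_coeff c j i (t - s) * \<bar>t - s\<bar> powr (H $ i + H $ j))"
    if "H $ i + H $ j \<noteq> 1" for i j s t
  proof -
    let ?h = "H $ i + H $ j"
    have coeff: "\<sigma> $ i * \<sigma> $ j * (signed_coeff c i j u * \<bar>u\<bar> powr ?h) =
        (\<rho> i j + sgn u * \<kappa> i j) * \<bar>u\<bar> powr ?h"
      "\<sigma> $ i * \<sigma> $ j * (signed_coeff c j i u * \<bar>u\<bar> powr ?h) =
        (\<rho> i j - sgn u * \<kappa> i j) * \<bar>u\<bar> powr ?h" for u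
      using \<sigma>_nz by (cases u "0 :: real" rule: linorder_cases;
        simp add: signed_coeff_def c_def \<rho>_swap[of j i] \<kappa>_swap[of j i])+
    have "K i j s t = \<kappa> i j *
        (sgn s * \<bar>s\<bar> powr ?h - sgn t * \<bar>t\<bar> powr ?h + sgn (t - s) * \<bar>t - s\<bar> powr ?h)"
      unfolding K_def \<kappa>_def by (rule scaling_kernel.antisymmetric_part[OF kernel that])
    then have "2 * G i j s t = (\<rho> i j + sgn s * \<kappa> i j) * \<bar>s\<bar> powr ?h
        + (\<rho> i j - sgn t * \<kappa> i j) * \<bar>t\<bar> powr ?h
        - (\<rho> i j - sgn (t - s) * \<kappa> i j) * \<bar>t - s\<bar> powr ?h"
      unfolding G_eq by (simp add: algebra_simps)
    also have "\<dots> = \<sigma> $ i * \<sigma> $ j * (signed_coeff c i j s * \<bar>s\<bar> powr ?h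
        + signed_coeff c j i t * \<bar>t\<bar> powr ?h - signed_coeff c j i (t - s) * \<bar>t - s\<bar> powr ?h)"
      unfolding coeff[symmetric] by (simp only: distrib_left right_diff_distrib)
    finally show ?thesis by (rule half)
  qed
  moreover have "G i j s t = \<sigma> $ i * \<sigma> $ j / 2 *
      (d i j * (\<bar>s\<bar> + \<bar>t\<bar> - \<bar>s - t\<bar>)
       + f i j * (t * ln \<bar>t\<bar> - s * ln \<bar>s\<bar> - (t - s) * ln \<bar>t - s\<bar>))"
    if h1: "H $ i + H $ j = 1" for i j s t
  proof -
    let ?S = "\<bar>s\<bar> + \<bar>t\<bar> - \<bar>s - t\<bar>"
    let ?L = "t * ln \<bar>t\<bar> - s * ln \<bar>s\<bar> - (t - s) * ln \<bar>t - s\<bar>"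
    have "\<bar>u\<bar> powr 1 = \<bar>u\<bar>" for u :: real by (rule powr_one) simp
    then have "2 * G i j s t = \<rho> i j * ?S + e i j * ?L"
      unfolding G_eq e[OF h1] h1 abs_minus_commute[of s t] by simp
    also have "\<rho> i j = \<sigma> $ i * \<sigma> $ j * d i j"
      using \<sigma>_nz by (simp add: d_def)
    also have "e i j = \<sigma> $ i * \<sigma> $ j * f i j"
      using \<sigma>_nz by (simp add: f_def)
    finally have "2 * G i j s t = \<sigma> $ i * \<sigma> $ j * (d i j * ?S + f i j * ?L)"
      by (simp only: distrib_left mult.assoc)
    then show ?thesis by (rule half)
  qed
  moreover have "nonneg_definite (R_matrix H c d)"
  proof -
    have "R_matrix H c d = (\<chi> i j. LINT \<omega>|M. X 1 \<omega> $ i / \<sigma> $ i * (X 1 \<omega> $ j / \<sigma> $ j))"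
    proof -
      (* The skew coefficient cancels in c i j + c j i, which leaves the correlation at time 1. *)
      have "R_matrix H c d $ i $ j = \<rho> i j / (\<sigma> $ i * \<sigma> $ j)" for i j
      proof (cases "i = j")
        case True
        then show ?thesis
          using \<sigma>_nz by (simp add: R_matrix_def \<rho>_diag power2_eq_square)
      next
        case False
        have "c j i = (\<rho> i j - \<kappa> i j) / (\<sigma> $ i * \<sigma> $ j)"
          by (simp add: c_def \<rho>_swap[of j i] \<kappa>_swap[of j i] mult.commute)
        then have "(c i j + c j i) / 2 = \<rho> i j / (\<sigma> $ i * \<sigma> $ j)"
          by (simp add: c_def add_divide_distrib diff_divide_distrib)
        then show ?thesis using False by (simp add: R_matrix_def d_def)
      qed
      then show ?thesis by (simp add: vec_eq_iff \<rho>_def G_def)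
    qed
    also have "nonneg_definite \<dots>"
      by (rule nonneg_definite_Gram) (simp add: int)
    finally show ?thesis .
  qed
  ultimately show ?thesis
    unfolding G_def by (intro exI[of _ c] exI[of _ d] exI[of _ f]) auto
qed

end
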